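(* For every integer $n\ge 0$, the Askey-Wilson moments for $c=d=0$ are $$2^n\mu_n(a,b,0,0;q) = \sum_{k=0}^{n} \left( \binom{n}{\frac{n-k}2}-\binom{n}{\frac{n-k}2-1}\right) \sum_{u+v+2t=k} a^u b^v (-1)^{t} q^{\binom{t+1}2} \begin{bmatrix} u+v+t\\ u,v,t\end{bmatrix}_q,$$ where the second sum is over all nonnegative integers $u,v,t$ satisfying $u+v+2t=k$.
   Context: Let $a,b,c,d,q$ be indeterminates (generic parameters). The monic Askey-Wilson polynomials $P_n(x)=P_n(x;a,b,c,d;q)$ are defined by $P_{-1}=0$, $P_0=1$, $P_{n+1}=(x-b_n)P_n-\lambda_nP_{n-1}$, with $b_n=\frac12(a+a^{-1}-(A_n+C_n))$, $\lambda_n=\frac14A_{n-1}C_n$, where $$A_n=\frac{(1-abq^n)(1-acq^n)(1-adq^n)(1-abcdq^{n-1})}{a(1-abcdq^{2n-1})(1-abcdq^{2n})},\quad C_n=\frac{a(1-q^n)(1-bcq^{n-1})(1-bdq^{n-1})(1-cdq^{n-1})}{(1-abcdq^{2n-2})(1-abcdq^{2n-1})}$$ (for $n=0$ the common factor $1-abcdq^{-1}$ in $A_0$ is cancelled, and $C_0=0$). The moment $\mu_n(a,b,c,d;q)=L(x^n)$, where $L$ is the unique linear functional on polynomials in $x$ with $L(1)=1$ and $L(P_n)=0$ for all $n\ge1$ (so that $L(P_mP_n)=0$ for $m\neq n$). It is a rational function of $a,b,c,d,q$, symmetric in $a,b,c,d$; here it is specialized at $c=d=0$. Notation: $(x;q)_m=\prod_{i=0}^{m-1}(1-xq^i)$;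 $\begin{bmatrix} u+v+t\\ u,v,t\end{bmatrix}_q=\frac{(q;q)_{u+v+t}}{(q;q)_u(q;q)_v(q;q)_t}$. $\binom{n}{r}=0$ unless $r$ is an integer with $0\le r\le n$ (so only $k\equiv n\bmod 2$ contribute). *)

theory Defs
  imports Complex_Main "HOL-Computational_Algebra.Polynomial"
begin

text \<open>
  The parameters \<open>a, b, c, d, q\<close> range over an arbitrary field of characteristic \<open>0\<close>.
  Independent indeterminates are the case in which the field is a field of rational functions.
\<close>

text \<open>
  For \<open>n = 0\<close> the factor \<open>1 - abcd q\<^sup>-\<^sup>1\<close>, which occurs in both the numerator and the denominator,
  is cancelled. For \<open>n \<ge> 1\<close> no exponent below is truncated.
\<close>

definition aw_A :: "'a::field_char_0 \<Rightarrow> 'a \<Rightarrow> 'a \<Rightarrow> 'a \<Rightarrow> 'a \<Rightarrow> nat \<Rightarrow> 'a" where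
  "aw_A a b c d q n =
     (if n = 0 then (1 - a*b) * (1 - a*c) * (1 - a*d) / (a * (1 - a*b*c*d))
      else (1 - a*b*q^n) * (1 - a*c*q^n) * (1 - a*d*q^n) * (1 - a*b*c*d*q^(n-1)) /
           (a * (1 - a*b*c*d*q^(2*n-1)) * (1 - a*b*c*d*q^(2*n))))"

definition aw_C :: "'a::field_char_0 \<Rightarrow> 'a \<Rightarrow> 'a \<Rightarrow> 'a \<Rightarrow> 'a \<Rightarrow> nat \<Rightarrow> 'a" where
  "aw_C a b c d q n =
     (if n = 0 then 0
      else a * (1 - q^n) * (1 - b*c*q^(n-1)) * (1 - b*d*q^(n-1)) * (1 - c*d*q^(n-1)) /
           ((1 - a*b*c*d*q^(2*n-2)) * (1 - a*b*c*d*q^(2*n-1))))"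

definition aw_b :: "'a::field_char_0 \<Rightarrow> 'a \<Rightarrow> 'a \<Rightarrow> 'a \<Rightarrow> 'a \<Rightarrow> nat \<Rightarrow> 'a" where
  "aw_b a b c d q n = 1/2 * (a + inverse a - (aw_A a b c d q n + aw_C a b c d q n))"

text \<open>Only used for \<open>n \<ge> 1\<close>.\<close>

definition aw_lambda :: "'a::field_char_0 \<Rightarrow> 'a \<Rightarrow> 'a \<Rightarrow> 'a \<Rightarrow> 'a \<Rightarrow> nat \<Rightarrow> 'a" where
  "aw_lambda a b c d q n = 1/4 * aw_A a b c d q (n-1) * aw_C a b c d q n"

text \<open>The second equation is the recurrence at index \<open>0\<close>, where the polynomial of index \<open>-1\<close> is \<open>0\<close>.\<close>

fun aw_poly :: "'a::field_char_0 \<Rightarrow> 'a \<Rightarrow> 'a \<Rightarrow> 'a \<Rightarrow> 'a \<Rightarrow> nat \<Rightarrow> 'a poly" where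
  "aw_poly a b c d q 0 = 1"
| "aw_poly a b c d q (Suc 0) = [:- aw_b a b c d q 0, 1:]"
| "aw_poly a b c d q (Suc (Suc n)) =
     [:- aw_b a b c d q (Suc n), 1:] * aw_poly a b c d q (Suc n)
     - smult (aw_lambda a b c d q (Suc n)) (aw_poly a b c d q n)"

definition is_aw_functional ::
  "'a::field_char_0 \<Rightarrow> 'a \<Rightarrow> 'a \<Rightarrow> 'a \<Rightarrow> 'a \<Rightarrow> ('a poly \<Rightarrow> 'a) \<Rightarrow> bool" where
  "is_aw_functional a b c d q L \<longleftrightarrow>
     Vector_Spaces.linear smult (*) L \<and> L 1 = 1 \<and> (\<forall>n\<ge>1. L (aw_poly a b c d q n) = 0)"

definition aw_functional :: "'a::field_char_0 \<Rightarrow> 'a \<Rightarrow> 'a \<Rightarrow> 'a \<Rightarrow> 'a \<Rightarrow> 'a poly \<Rightarrow> 'a" where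
  "aw_functional a b c d q = (THE L. is_aw_functional a b c d q L)"

definition aw_moment :: "nat \<Rightarrow> 'a::field_char_0 \<Rightarrow> 'a \<Rightarrow> 'a \<Rightarrow> 'a \<Rightarrow> 'a \<Rightarrow> 'a" where
  "aw_moment n a b c d q = aw_functional a b c d q (monom 1 n)"

definition qpoch :: "'a::field_char_0 \<Rightarrow> 'a \<Rightarrow> nat \<Rightarrow> 'a" where
  "qpoch x q m = (\<Prod>i<m. 1 - x * q^i)"

definition qtrinomial :: "'a::field_char_0 \<Rightarrow> nat \<Rightarrow> nat \<Rightarrow> nat \<Rightarrow> 'a" where
  "qtrinomial q u v t = qpoch q q (u + v + t) / (qpoch q q u * qpoch q q v * qpoch q q t)"

text \<open>Binomial coefficient that is \<open>0\<close> unless \<open>r\<close> is an integer with \<open>0 \<le> r \<le> n\<close>.\<close>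

definition binom0 :: "nat \<Rightarrow> rat \<Rightarrow> nat" where
  "binom0 n r = (if r \<in> \<int> \<and> 0 \<le> r \<and> r \<le> of_nat n then n choose nat \<lfloor>r\<rfloor> else 0)"

subsection \<open>The functional is well defined\<close>

lemma aw_poly_monic:
  "degree (aw_poly a b c d q n) = n \<and> coeff (aw_poly a b c d q n) n = 1"
proof (induction n rule: less_induct)
  case (less n)
  consider "n = 0" | "n = Suc 0" | m where "n = Suc (Suc m)"
    by (metis not0_implies_Suc)
  then show ?case
  proof cases
    case 3
    let ?P = "aw_poly a b c d q"
    have 1: "degree (?P (Suc m)) = Suc m" "coeff (?P (Suc m)) (Suc m) = 1"
      and 2: "degree (?P m) = m"
      using less 3 by auto
    have 0: "?P (Suc m) \<noteq> 0" using 1 by auto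
    have "coeff (?P n) n = 1"
      using 1 2 by (simp add: 3 coeff_eq_0)
    moreover have "degree (?P n) \<le> n"
      unfolding 3 aw_poly.simps
      by (rule degree_diff_le) (use 1 2 0 in \<open>auto simp: degree_mult_eq simp del: mult_pCons_left intro: order_trans[OF degree_smult_le]\<close>)
    ultimately show ?thesis
      by (metis le_antisym le_degree zero_neq_one)
  qed auto
qed

lemma linear_poly_iff:
  "Vector_Spaces.linear smult (*) (L :: 'a::field poly \<Rightarrow> 'a) \<longleftrightarrow>
     (\<forall>p r. L (p + r) = L p + L r) \<and> (\<forall>k p. L (smult k p) = k * L p)"
  by (auto simp: Vector_Spaces.linear_def module_hom_def module_hom_axioms_def
      vector_space_def module_def algebra_simps smult_add_left smult_add_right)

lemma aw_functional_exists:
  fixes a b c d q :: "'a::field_char_0"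
  shows "\<exists>L. is_aw_functional a b c d q L"
proof -
  let ?P = "aw_poly a b c d q"
  obtain m where m: "\<And>n. m n = (if n = 0 then 1 else - (\<Sum>i<n. coeff (?P n) i * m i))"
  proof -
    define G where "G = (\<lambda>m n. if n = 0 then 1 else - (\<Sum>i<n. coeff (?P n) i * m i))"
    have "wfrec less_than G n = G (wfrec less_than G) n" for n
      by (subst wfrec[OF wf_less_than]) (auto simp: G_def cut_def intro!: sum.cong)
    then show ?thesis using that[of "wfrec less_than G"] unfolding G_def by blast
  qed
  define L where "L = (\<lambda>p. \<Sum>i\<le>degree p. coeff p i * m i)"
  have L: "L p = (\<Sum>i\<le>N. coeff p i * m i)" if "degree p \<le> N" for p N
    unfolding L_def using that by (intro sum.mono_neutral_left) (auto simp: coeff_eq_0)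
  have "L (p + r) = L p + L r" for p r
  proof -
    let ?N = "max (degree p) (degree r)"
    have "degree (p + r) \<le> ?N" by (rule degree_add_le) auto
    then show ?thesis by (simp add: L[of _ ?N] algebra_simps sum.distrib)
  qed
  moreover have "L (smult k p) = k * L p" for k p
    by (simp add: L[of _ "degree p"] degree_smult_le sum_distrib_left mult.assoc)
  moreover have "L 1 = 1" by (simp add: L_def m[of 0])
  moreover have "L (?P n) = 0" if "n \<ge> 1" for n
    using that aw_poly_monic[of a b c d q n] m[of n] by (simp add: L_def lessThan_Suc_atMost[symmetric])
  ultimately have "is_aw_functional a b c d q L"
    by (simp add: is_aw_functional_def linear_poly_iff)
  then show ?thesis by (intro exI[of _ L])
qed

lemma aw_functional_unique:
  assumes L: "is_aw_functional a b c d q L" and M: "is_aw_functional a b c d q M"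
  shows "L = M"
proof
  fix p
  show "L p = M p"
  proof (induction "degree p" arbitrary: p rule: less_induct)
    case less
    let ?P = "aw_poly a b c d q (degree p)"
    let ?k = "lead_coeff p"
    note lin = L[unfolded is_aw_functional_def linear_poly_iff] M[unfolded is_aw_functional_def linear_poly_iff]
    have eq: "L (smult ?k ?P) = M (smult ?k ?P)"
    proof (cases "degree p = 0")
      case True
      then show ?thesis using lin by (metis aw_poly.simps(1))
    next
      case False
      then have "1 \<le> degree p" by simp
      then show ?thesis using lin by metis
    qed
    define r where "r = p - smult ?k ?P"
    have p: "p = smult ?k ?P + r" by (simp add: r_def)
    have "L r = M r"
    proof (cases "degree p = 0")
      case True
      then obtain e where "p = [:e:]" by (rule degree_eq_zeroE)
      then have "r = smult 0 1" by (simp add: r_def)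
      then show ?thesis using lin by (metis mult_zero_left)
    next
      case False
      have "degree r \<le> degree p"
        unfolding r_def using aw_poly_monic[of a b c d q "degree p"] 
        by (intro degree_diff_le) (auto intro: order_trans[OF degree_smult_le])
      moreover have "coeff r (degree p) = 0"
        unfolding r_def using aw_poly_monic[of a b c d q "degree p"] by simp
      ultimately have "degree r < degree p"
        using False by (metis degree_0 gr0I le_neq_implies_less leading_coeff_0_iff)
      then show ?thesis by (rule less)
    qed
    then show ?case using eq lin p by metis
  qed
qed

lemma aw_functional_ex1: "\<exists>!L. is_aw_functional a b c d q L"
  using aw_functional_exists aw_functional_unique by blast

lemma is_aw_functional_aw_functional: "is_aw_functional a b c d q (aw_functional a b c d q)"
  unfolding aw_functional_def by (rule theI'[OF aw_functional_ex1])

end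

theory Submission
  imports Defs
begin

text \<open>
  For \<open>c = d = 0\<close> and \<open>y = 2x\<close> the rescaled polynomials \<open>Q\<^sub>n = 2\<^sup>n P\<^sub>n\<close> are the Al-Salam--Chihara
  polynomials, \<open>Q\<^sub>n\<^sub>+\<^sub>1 = (y - (a + b) q\<^sup>n) Q\<^sub>n - (1 - a b q\<^sup>n\<^sup>-\<^sup>1) (1 - q\<^sup>n) Q\<^sub>n\<^sub>-\<^sub>1\<close>. The power \<open>y\<^sup>n\<close> is
  expanded in three steps: in Chebyshev polynomials \<open>U\<^sub>k\<close> of the second kind, with ballot numbers
  as coefficients; each \<open>U\<^sub>k\<close> in continuous \<open>q\<close>-Hermite polynomials \<open>H\<^sub>m\<close>; and each \<open>H\<^sub>m\<close> in the
  \<open>Q\<^sub>j\<close>, where the coefficient of \<open>Q\<^sub>0\<close> is the homogeneous Rogers--Szego polynomial in \<open>a\<close> and \<open>b\<close>.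
\<close>

section \<open>Gaussian binomial coefficients\<close>

definition qbinom :: "'a::field_char_0 \<Rightarrow> nat \<Rightarrow> nat \<Rightarrow> 'a" where
  "qbinom q n k = (if k \<le> n then qpoch q q n / (qpoch q q k * qpoch q q (n - k)) else 0)"

definition rogers_szego :: "'a::field_char_0 \<Rightarrow> 'a \<Rightarrow> 'a \<Rightarrow> nat \<Rightarrow> 'a" where
  "rogers_szego a b q n = (\<Sum>u\<le>n. qbinom q n u * a ^ u * b ^ (n - u))"

lemma qpoch_0 [simp]: "qpoch x q 0 = 1"
  by (simp add: qpoch_def)

lemma qpoch_Suc: "qpoch x q (Suc n) = qpoch x q n * (1 - x * q ^ n)"
  by (simp add: qpoch_def)

lemma qbinom_eq_0 [simp]: "n < k \<Longrightarrow> qbinom q n k = 0"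
  by (simp add: qbinom_def)

context
  fixes q :: "'a::field_char_0"
  assumes no_root: "\<forall>m\<ge>1. q ^ m \<noteq> 1"
begin

lemma one_minus_power_nonzero: "1 - q ^ Suc m \<noteq> 0"
  using no_root[rule_format, of "Suc m"] by auto

lemma qpoch_nonzero: "qpoch q q n \<noteq> 0"
  by (induction n) (use one_minus_power_nonzero in \<open>auto simp: qpoch_Suc\<close>)

lemma qbinom_0 [simp]: "qbinom q n 0 = 1"
  by (simp add: qbinom_def qpoch_nonzero)

lemma qbinom_Suc_absorb: "(1 - q ^ Suc k) * qbinom q (Suc n) (Suc k) = (1 - q ^ Suc n) * qbinom q n k"
  using one_minus_power_nonzero[of k] by (simp add: qbinom_def qpoch_Suc)

text \<open>Cancels the last factor of the second denominator. For \<open>k = Suc n\<close> the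
  truncated exponent gives \<open>1 - q ^ 0 = 0\<close>; beyond that both coefficients
  vanish.\<close>

lemma qbinom_absorb_comp: "(1 - q ^ (Suc n - k)) * qbinom q (Suc n) k = (1 - q ^ Suc n) * qbinom q n k"
proof (cases "k \<le> n")
  case True
  then have "Suc n - k = Suc (n - k)" by simp
  then show ?thesis
    using True one_minus_power_nonzero[of "n - k"] by (simp add: qbinom_def qpoch_Suc)
next
  case False
  then show ?thesis by (cases "k = Suc n") auto
qed

text \<open>After multiplication by \<open>1 - q ^ Suc n\<close>, the two absorption rules turn both
  summands into multiples of \<open>qbinom q (Suc n) (Suc k)\<close>, whose factors add up to
  \<open>1 - q ^ Suc n\<close> again.\<close>

lemma qbinom_Pascal: "qbinom q (Suc n) (Suc k) = qbinom q n k + q ^ Suc k * qbinom q n (Suc k)"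
proof (cases "k \<le> n")
  case True
  have pow: "q ^ Suc k * q ^ (n - k) = q ^ Suc n"
    using True by (simp flip: power_add)
  have "(1 - q ^ Suc n) * (qbinom q n k + q ^ Suc k * qbinom q n (Suc k))
      = (1 - q ^ Suc n) * qbinom q n k + q ^ Suc k * ((1 - q ^ Suc n) * qbinom q n (Suc k))"
    by (simp add: algebra_simps)
  also have "\<dots> = (1 - q ^ Suc k) * qbinom q (Suc n) (Suc k)
      + q ^ Suc k * ((1 - q ^ (n - k)) * qbinom q (Suc n) (Suc k))"
    by (simp only: qbinom_Suc_absorb qbinom_absorb_comp[of n "Suc k", symmetric] diff_Suc_Suc)
  also have "\<dots> = (1 - q ^ Suc k * q ^ (n - k)) * qbinom q (Suc n) (Suc k)"
    by (simp add: algebra_simps)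
  finally show ?thesis
    using one_minus_power_nonzero[of n] unfolding pow by (metis mult_left_cancel)
qed simp

lemma qbinom_neighbor: "(1 - q ^ Suc k) * qbinom q n (Suc k) = (1 - q ^ (n - k)) * qbinom q n k"
proof -
  have "(1 - q ^ (n - k)) * qbinom q n k = (1 - q ^ Suc k) * qbinom q n (Suc k)"
  proof (cases n)
    case (Suc m)
    then show ?thesis
      by (simp only: qbinom_Suc_absorb qbinom_absorb_comp)
  qed simp
  then show ?thesis by simp
qed

lemma qbinom_Pascal': "qbinom q (Suc n) (Suc k) = qbinom q n (Suc k) + q ^ (n - k) * qbinom q n k"
  using qbinom_Pascal[of n k] qbinom_neighbor[of k n] by (simp add: algebra_simps)

text \<open>Merges a coefficient of the step from \<open>cheb_U\<close> to \<open>q_hermite\<close>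
  with one of \<open>rogers_szego\<close> into the trinomial of the final formula.\<close>

lemma qbinom_mult_qbinom:
  "qbinom q (u + v + t) t * qbinom q (u + v) u = qtrinomial q u v t"
  by (simp add: qbinom_def qtrinomial_def qpoch_nonzero)

lemma rogers_szego_0 [simp]: "rogers_szego a b q 0 = 1"
  by (simp add: rogers_szego_def)

lemma qbinom_1_1 [simp]: "qbinom q (Suc 0) (Suc 0) = 1"
  by (simp add: qbinom_def qpoch_nonzero)

lemma rogers_szego_1: "rogers_szego a b q (Suc 0) = a + b"
  by (simp add: rogers_szego_def)

lemma rogers_szego_rec:
  "rogers_szego a b q (Suc (Suc n))
   = (a + b) * rogers_szego a b q (Suc n) - a * b * (1 - q ^ Suc n) * rogers_szego a b q n"
proof -
  \<comment> \<open>All sums are aligned on the monomials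
    \<open>a ^ Suc u * b ^ (Suc n - u)\<close>; the remaining power \<open>b ^ Suc (Suc n)\<close>
    is split off. The recurrence then reduces to an identity between coefficients.\<close>
  let ?S = "\<lambda>c. \<Sum>u\<le>Suc n. c u * a ^ Suc u * b ^ (Suc n - u)"
  have "rogers_szego a b q (Suc (Suc n)) = b ^ Suc (Suc n) + ?S (\<lambda>u. qbinom q (Suc (Suc n)) (Suc u))"
    unfolding rogers_szego_def by (subst sum.atMost_Suc_shift) simp
  moreover have "a * rogers_szego a b q (Suc n) = ?S (qbinom q (Suc n))"
    unfolding rogers_szego_def sum_distrib_left by (rule sum.cong) auto
  moreover have "b * rogers_szego a b q (Suc n) = b ^ Suc (Suc n) + ?S (\<lambda>u. qbinom q (Suc n) (Suc u))"
    unfolding rogers_szego_def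
    by (subst sum.atMost_Suc_shift)
      (auto simp: sum_distrib_left algebra_simps Suc_diff_le intro!: sum.cong)
  moreover have "a * b * rogers_szego a b q n = ?S (qbinom q n)"
    unfolding rogers_szego_def
    by (auto simp: sum_distrib_left Suc_diff_le intro!: sum.cong)
  moreover have "?S (\<lambda>u. qbinom q (Suc (Suc n)) (Suc u))
      = ?S (qbinom q (Suc n)) + ?S (\<lambda>u. qbinom q (Suc n) (Suc u)) - (1 - q ^ Suc n) * ?S (qbinom q n)"
  proof -
    have coeff: "qbinom q (Suc (Suc n)) (Suc u)
        = qbinom q (Suc n) u + qbinom q (Suc n) (Suc u) - (1 - q ^ Suc n) * qbinom q n u" for u
      using qbinom_Pascal[of "Suc n" u] qbinom_Suc_absorb[of u n] by (simp add: algebra_simps)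
    show ?thesis
      unfolding coeff sum_distrib_left sum.distrib[symmetric] sum_subtractf[symmetric]
      by (rule sum.cong) (simp_all add: algebra_simps)
  qed
  ultimately show ?thesis
    by (simp add: distrib_right mult.assoc mult.left_commute[of _ "1 - q * q ^ n"])
qed

end

section \<open>Expansions in three-term recurrent sequences\<close>

lemma smult_sum_right: "smult c (\<Sum>i\<in>A. f i) = (\<Sum>i\<in>A. smult c (f i))"
  by (induction A rule: infinite_finite_induct) (simp_all add: smult_add_right)

text \<open>Moves multiplication by \<open>y\<close> from the basis to the coefficients. The term
  \<open>Q (0 - 1)\<close> is harmless because \<gamma> vanishes at 0, and the vanishing of
  \<open>c\<close> beyond \<open>n\<close> lets the three shifted sums share one range.\<close>

lemma three_term_sum:
  fixes Q :: "nat \<Rightarrow> 'a::comm_ring_1 poly"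
  assumes rec: "\<And>m. y * Q m = Q (Suc m) + smult (\<beta> m) (Q m) + smult (\<gamma> m) (Q (m - 1))"
    and \<gamma>: "\<gamma> 0 = 0" and c: "\<And>m. m > n \<Longrightarrow> c m = 0"
  shows "y * (\<Sum>m\<le>n. smult (c m) (Q m))
    = (\<Sum>m\<le>Suc n. smult ((if m = 0 then 0 else c (m - 1)) + \<beta> m * c m + \<gamma> (Suc m) * c (Suc m)) (Q m))"
proof -
  have "y * (\<Sum>m\<le>n. smult (c m) (Q m)) = (\<Sum>m\<le>n. smult (c m) (y * Q m))"
    by (simp add: sum_distrib_left)
  also have "\<dots> = (\<Sum>m\<le>n. smult (c m) (Q (Suc m))) + (\<Sum>m\<le>n. smult (\<beta> m * c m) (Q m))
      + (\<Sum>m\<le>n. smult (\<gamma> m * c m) (Q (m - 1)))"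
    by (simp add: rec smult_add_right sum.distrib mult.commute)
  also have "(\<Sum>m\<le>n. smult (c m) (Q (Suc m))) = (\<Sum>m\<le>Suc n. smult (if m = 0 then 0 else c (m - 1)) (Q m))"
    by (subst sum.atMost_Suc_shift) simp
  also have "(\<Sum>m\<le>n. smult (\<beta> m * c m) (Q m)) = (\<Sum>m\<le>Suc n. smult (\<beta> m * c m) (Q m))"
    by (simp add: c)
  also have "(\<Sum>m\<le>n. smult (\<gamma> m * c m) (Q (m - 1))) = (\<Sum>m\<le>Suc (Suc n). smult (\<gamma> m * c m) (Q (m - 1)))"
    by (simp add: c)
  also have "\<dots> = (\<Sum>m\<le>Suc n. smult (\<gamma> (Suc m) * c (Suc m)) (Q m))"
    by (subst sum.atMost_Suc_shift) (simp add: \<gamma>)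
  finally show ?thesis
    by (simp only: sum.distrib[symmetric] smult_add_left[symmetric])
qed

section \<open>Powers of 2x in Chebyshev polynomials, with ballot numbers\<close>

fun cheb_U :: "nat \<Rightarrow> 'a::field_char_0 poly" where
  "cheb_U 0 = 1"
| "cheb_U (Suc 0) = [:0, 2:]"
| "cheb_U (Suc (Suc n)) = [:0, 2:] * cheb_U (Suc n) - cheb_U n"

fun q_hermite :: "'a::field_char_0 \<Rightarrow> nat \<Rightarrow> 'a poly" where
  "q_hermite q 0 = 1"
| "q_hermite q (Suc 0) = [:0, 2:]"
| "q_hermite q (Suc (Suc n)) = [:0, 2:] * q_hermite q (Suc n) - smult (1 - q ^ Suc n) (q_hermite q n)"

text \<open>The argument is rational so that half-integers, which stem from \<open>k\<close> of the
  wrong parity, give 0 and no parity split is needed.\<close>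

definition ballot :: "nat \<Rightarrow> rat \<Rightarrow> 'a::field_char_0" where
  "ballot n r = of_nat (binom0 n r) - of_nat (binom0 n (r - 1))"

lemma binom0_of_nat: "binom0 n (of_nat r) = n choose r"
  by (auto simp: binom0_def)

lemma Ints_nonneg_of_nat:
  fixes r :: "'a::linordered_idom"
  assumes "r \<in> \<int>" "0 \<le> r"
  obtains k where "r = of_nat k"
proof -
  from assms(1) obtain z where z: "r = of_int z" by (rule Ints_cases)
  then have "r = of_nat (nat z)" using assms(2) by simp
  then show ?thesis by (rule that)
qed

lemma binom0_not_nat: "(\<And>k. r \<noteq> of_nat k) \<Longrightarrow> binom0 n r = 0"
  unfolding binom0_def by (auto elim: Ints_nonneg_of_nat)

lemma binom0_neg: "r < 0 \<Longrightarrow> binom0 n r = 0"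
  by (simp add: binom0_def)

lemma binom0_Suc: "binom0 (Suc n) r = binom0 n r + binom0 n (r - 1)"
proof (cases "\<exists>k. r = of_nat k")
  case True
  then obtain k where k: "r = of_nat k" by blast
  show ?thesis
  proof (cases k)
    case 0
    then show ?thesis using binom0_of_nat[of _ 0] by (simp add: k binom0_neg)
  next
    case (Suc j)
    then have "r - 1 = of_nat j" by (simp add: k)
    then show ?thesis by (simp only: k binom0_of_nat) (simp add: Suc)
  qed
next
  case False
  have "r - 1 \<noteq> of_nat k" for k
  proof
    assume "r - 1 = of_nat k"
    then have "r = of_nat (Suc k)" by (simp add: algebra_simps)
    with False show False by blast
  qed
  then show ?thesis using False by (simp add: binom0_not_nat)
qed

lemma binom0_symmetric: "binom0 n (of_nat n - r) = binom0 n r"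
proof (cases "\<exists>k\<le>n. r = of_nat k")
  case True
  then obtain k where k: "k \<le> n" "r = of_nat k" by blast
  then have "of_nat n - r = of_nat (n - k)" by simp
  then show ?thesis
    by (simp only: k(2) binom0_of_nat binomial_symmetric[OF k(1), symmetric])
next
  case False
  then have "\<not> (r \<in> \<int> \<and> 0 \<le> r \<and> r \<le> of_nat n)"
    by (auto elim!: Ints_nonneg_of_nat)
  moreover have "\<not> (of_nat n - r \<in> \<int> \<and> 0 \<le> of_nat n - r \<and> of_nat n - r \<le> of_nat n)"
  proof
    assume *: "of_nat n - r \<in> \<int> \<and> 0 \<le> of_nat n - r \<and> of_nat n - r \<le> of_nat n"
    then have "of_nat n - (of_nat n - r) \<in> \<int>" by (intro Ints_diff) auto
    then have "r \<in> \<int>" by simp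
    with * calculation show False by simp
  qed
  ultimately show ?thesis
    by (simp only: binom0_def if_False)
qed

lemma ballot_Suc: "ballot (Suc n) r = ballot n r + ballot n (r - 1)"
  by (simp add: ballot_def binom0_Suc)

lemma ballot_neg: "r < 0 \<Longrightarrow> ballot n r = 0"
  by (simp add: ballot_def binom0_neg)

text \<open>The reflection of \<open>r\<close> to \<open>n - r\<close> swaps (n+1)/2 and (n-1)/2.
  This is the boundary condition at \<open>k = 0\<close> in the Chebyshev expansion.\<close>

lemma ballot_middle: "ballot n ((of_nat n + 1) / 2) = 0"
proof -
  have "of_nat n - (of_nat n + 1) / 2 = (of_nat n + 1) / 2 - (1::rat)"
    by (simp add: field_simps)
  then have "binom0 n ((of_nat n + 1) / 2 - 1) = binom0 n ((of_nat n + 1) / 2)"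
    using binom0_symmetric[of n "(of_nat n + 1) / 2"] by (simp only:)
  then show ?thesis by (simp add: ballot_def)
qed

lemma power_eq_sum_cheb_U:
  "[:0, 2 :: 'a::field_char_0:] ^ n = (\<Sum>k\<le>n. smult (ballot n ((of_nat n - of_nat k) / 2)) (cheb_U k))"
proof (induction n)
  case 0
  have "ballot 0 0 = (1 :: 'a)"
    using binom0_of_nat[of 0 0] by (simp add: ballot_def binom0_neg)
  then show ?case by simp
next
  case (Suc n)
  define c :: "nat \<Rightarrow> 'a" where "c k = ballot n ((of_nat n - of_nat k) / 2)" for k
  define \<gamma> :: "nat \<Rightarrow> 'a" where "\<gamma> k = (if k = 0 then 0 else 1)" for k
  have rec: "[:0, 2:] * cheb_U k = cheb_U (Suc k) + smult 0 (cheb_U k) + smult (\<gamma> k) (cheb_U (k - 1))"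
    for k
    by (cases k) (auto simp: \<gamma>_def)
  have zero: "c k = 0" if "k > n" for k
    using that by (simp add: c_def ballot_neg)
  have coeff: "(if k = 0 then 0 else c (k - 1)) + 0 * c k + \<gamma> (Suc k) * c (Suc k)
      = ballot (Suc n) ((of_nat (Suc n) - of_nat k) / 2)" for k
  proof -
    have pred: "(of_nat (Suc n) - of_nat k) / 2 - 1 = (of_nat n - of_nat (Suc k)) / (2::rat)"
      by (simp add: field_simps)
    \<comment> \<open>At level \<open>n\<close> this argument belongs to index k-1; for
      \<open>k = 0\<close> that index would be -1, and the coefficient vanishes by
      \<open>ballot_middle\<close>.\<close>
    have same: "ballot n ((of_nat (Suc n) - of_nat k) / 2) = (if k = 0 then 0 else c (k - 1))"
    proof (cases k)
      case 0
      then have "(of_nat (Suc n) - of_nat k) / 2 = (of_nat n + 1) / (2::rat)" by simp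
      then show ?thesis using 0 by (simp only: ballot_middle) simp
    next
      case (Suc j)
      then have "(of_nat (Suc n) - of_nat k) / 2 = (of_nat n - of_nat j) / (2::rat)" by simp
      then show ?thesis by (simp only: c_def) (simp add: Suc)
    qed
    show ?thesis
      unfolding ballot_Suc pred same by (simp add: c_def \<gamma>_def)
  qed
  have "[:0, 2:] ^ Suc n = [:0, 2:] * (\<Sum>k\<le>n. smult (c k) (cheb_U k))"
    by (simp add: Suc c_def)
  also have "\<dots> = (\<Sum>k\<le>Suc n. smult (ballot (Suc n) ((of_nat (Suc n) - of_nat k) / 2)) (cheb_U k))"
    by (subst three_term_sum[OF rec _ zero]) (simp_all only: coeff, simp add: \<gamma>_def)
  finally show ?case .
qed

section \<open>From Chebyshev to q-Hermite to Al-Salam--Chihara polynomials\<close>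

context
  fixes q :: "'a::field_char_0"
  assumes no_root: "\<forall>m\<ge>1. q ^ m \<noteq> 1"
begin

text \<open>
  The truncated index \<open>k - 2 * t\<close> is harmless: the coefficient vanishes for \<open>2 * t > k\<close>.
\<close>

lemma cheb_U_eq_sum_q_hermite:
  "cheb_U k = (\<Sum>t\<le>k. smult ((-1) ^ t * q ^ (Suc t choose 2) * qbinom q (k - t) t) (q_hermite q (k - 2 * t)))"
proof -
  define d where "d k t = (-1) ^ t * q ^ (Suc t choose 2) * qbinom q (k - t) t" for k t
  have d0: "d k 0 = 1" for k
    by (simp add: d_def qbinom_0[OF no_root] binomial_eq_0)
  have d_eq_0: "d k t = 0" if "2 * t > k" for k t
    using that by (cases "t = 0") (simp_all add: d_def)
  \<comment> \<open>This compares the coefficients of \<open>q_hermite q (k - 2 * t)\<close> in the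
    Chebyshev recurrence, after the q-Hermite recurrence has been applied to each product with
    2x.\<close>
  have d_rec: "d (Suc (Suc k)) (Suc t) = d (Suc k) (Suc t) + (1 - q ^ (Suc k - 2 * t)) * d (Suc k) t - d k t"
    for k t
  proof (cases "2 * t \<le> k")
    case True
    define N where "N = k - t"
    have N: "Suc (Suc k) - Suc t = Suc N" "Suc k - Suc t = N" "Suc k - t = Suc N" "k - t = N"
      "Suc k - 2 * t = Suc N - t" "Suc t \<le> Suc N"
      using True by (auto simp: N_def)
    have "Suc (Suc t) choose 2 = (Suc t choose 2) + Suc t"
      using binomial_Suc_Suc[of "Suc t" 1] by (simp only: Suc_1 choose_one add.commute)
    then have pow: "q ^ (Suc (Suc t) choose 2) = q ^ (Suc t choose 2) * q ^ Suc t"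
      by (simp only: power_add)
    have N2: "q ^ Suc t * q ^ (N - t) = q ^ Suc N"
      using True by (simp add: N_def flip: power_add)
    \<comment> \<open>The factor \<open>q ^ Suc t\<close> is the growth of the power of
      \<open>q\<close> from \<open>t\<close> to \<open>Suc t\<close>. With it, the second Pascal
      rule acquires the power \<open>q ^ Suc N\<close>, which absorption can rewrite.\<close>
    have "q ^ Suc t * qbinom q (Suc N) (Suc t)
        = q ^ Suc t * qbinom q N (Suc t) + q ^ Suc N * qbinom q N t"
      unfolding qbinom_Pascal'[OF no_root] N2[symmetric] by (simp only: distrib_left mult.assoc)
    then have "q ^ Suc t * qbinom q (Suc N) (Suc t)
        = q ^ Suc t * qbinom q N (Suc t) - (1 - q ^ (Suc N - t)) * qbinom q (Suc N) t + qbinom q N t"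
      unfolding qbinom_absorb_comp[OF no_root] by (simp add: algebra_simps)
    then have "- ((-1) ^ t * q ^ (Suc t choose 2)) * (q ^ Suc t * qbinom q (Suc N) (Suc t))
       = - ((-1) ^ t * q ^ (Suc t choose 2)) * (q ^ Suc t * qbinom q N (Suc t)
           - (1 - q ^ (Suc N - t)) * qbinom q (Suc N) t + qbinom q N t)"
      by (rule arg_cong)
    then show ?thesis
      unfolding d_def N pow by (simp add: algebra_simps)
  next
    case False
    \<comment> \<open>If \<open>2 * t = Suc k\<close>, then \<open>d (Suc k) t\<close> need not
      vanish, but its factor is \<open>1 - q ^ 0 = 0\<close>.\<close>
    then show ?thesis by (simp add: d_eq_0)
  qed
  have "cheb_U k = (\<Sum>t\<le>k. smult (d k t) (q_hermite q (k - 2 * t)))"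
  proof (induction k rule: cheb_U.induct)
    case 1
    show ?case by (simp add: d0)
  next
    case 2
    show ?case by (simp add: d0 d_eq_0)
  next
    case (3 k)
    let ?H = "q_hermite q"
    let ?g = "\<lambda>t. 1 - q ^ (Suc k - 2 * t)"
    \<comment> \<open>For \<open>2 * t \<le> k\<close> this is the q-Hermite recurrence. For
      \<open>2 * t = Suc k\<close> it says that 2x times the polynomial of index 0 is the one of
      index 1, the last summand having factor 0.\<close>
    have step: "smult (d (Suc k) t) ([:0, 2:] * ?H (Suc k - 2 * t))
      = smult (d (Suc k) t) (?H (Suc (Suc k) - 2 * t)) + smult (?g t * d (Suc k) t) (?H (k - 2 * t))" for t
    proof (cases "2 * t \<le> Suc k")
      case True
      then consider "2 * t = Suc k" | "2 * t \<le> k" by linarith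
      then show ?thesis
      proof cases
        case 2
        then have "Suc (Suc k) - 2 * t = Suc (Suc (k - 2 * t))" "Suc k - 2 * t = Suc (k - 2 * t)"
          by auto
        then show ?thesis by (simp add: smult_diff_right algebra_simps del: mult_pCons_left)
      qed (simp add: Suc_diff_le)
    qed (simp add: d_eq_0)
    have "[:0, 2:] * cheb_U (Suc k) = (\<Sum>t\<le>Suc k. smult (d (Suc k) t) ([:0, 2:] * ?H (Suc k - 2 * t)))"
      unfolding 3 sum_distrib_left mult_smult_right ..
    also have "\<dots> = (\<Sum>t\<le>Suc k. smult (d (Suc k) t) (?H (Suc (Suc k) - 2 * t)))
        + (\<Sum>t\<le>Suc k. smult (?g t * d (Suc k) t) (?H (k - 2 * t)))"
      unfolding step sum.distrib ..
    also have "(\<Sum>t\<le>Suc k. smult (d (Suc k) t) (?H (Suc (Suc k) - 2 * t)))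
        = (\<Sum>t\<le>Suc (Suc k). smult (d (Suc k) t) (?H (Suc (Suc k) - 2 * t)))"
      by (simp add: d_eq_0)
    also have "\<dots> = ?H (Suc (Suc k)) + (\<Sum>t\<le>Suc k. smult (d (Suc k) (Suc t)) (?H (k - 2 * t)))"
      by (subst sum.atMost_Suc_shift) (simp add: d0 del: q_hermite.simps)
    finally have y: "[:0, 2:] * cheb_U (Suc k) = ?H (Suc (Suc k))
      + (\<Sum>t\<le>Suc k. smult (d (Suc k) (Suc t)) (?H (k - 2 * t)))
      + (\<Sum>t\<le>Suc k. smult (?g t * d (Suc k) t) (?H (k - 2 * t)))" .
    have U: "cheb_U k = (\<Sum>t\<le>Suc k. smult (d k t) (?H (k - 2 * t)))"
      using 3 by (simp add: d_eq_0)
    have "(\<Sum>t\<le>Suc (Suc k). smult (d (Suc (Suc k)) t) (?H (Suc (Suc k) - 2 * t)))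
        = ?H (Suc (Suc k)) + (\<Sum>t\<le>Suc k. smult (d (Suc (Suc k)) (Suc t)) (?H (k - 2 * t)))"
      by (subst sum.atMost_Suc_shift) (simp add: d0 del: q_hermite.simps)
    also have "\<dots> = [:0, 2:] * cheb_U (Suc k) - cheb_U k"
      unfolding y U d_rec smult_diff_left smult_add_left sum.distrib sum_subtractf
      by (simp only: add_diff_eq add.assoc)
    finally show ?case by (simp only: cheb_U.simps)
  qed
  then show ?thesis by (simp only: d_def)
qed

text \<open>Both sides obey the q-Hermite recurrence in \<open>n\<close>. In \<open>rec\<close> the
  truncated indices at \<open>m = 0\<close> do no harm, since the factor \<open>1 - q ^ 0\<close>
  kills that term.\<close>

lemma q_hermite_eq_sum:
  fixes Q :: "nat \<Rightarrow> 'a poly"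
  assumes Q0: "Q 0 = 1"
    and rec: "\<And>m. [:0, 2:] * Q m = Q (Suc m) + smult ((a + b) * q ^ m) (Q m)
               + smult ((1 - a * b * q ^ (m - 1)) * (1 - q ^ m)) (Q (m - 1))"
  shows "q_hermite q n = (\<Sum>m\<le>n. smult (qbinom q n m * rogers_szego a b q (n - m)) (Q m))"
proof (induction n rule: cheb_U.induct)
  case 1
  show ?case by (simp add: Q0 qbinom_0[OF no_root] rogers_szego_0[OF no_root])
next
  case 2
  show ?case
    using rec[of 0]
    by (simp add: Q0 qbinom_0[OF no_root] qbinom_1_1[OF no_root] rogers_szego_0[OF no_root]
        rogers_szego_1[OF no_root])
next
  case (3 n)
  let ?r = "rogers_szego a b q"
  let ?c = "\<lambda>m. qbinom q (Suc n) m * ?r (Suc n - m)"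
  have coeff: "(if m = 0 then 0 else ?c (m - 1)) + (a + b) * q ^ m * ?c m
       + (1 - a * b * q ^ (Suc m - 1)) * (1 - q ^ Suc m) * ?c (Suc m)
       - (1 - q ^ Suc n) * (qbinom q n m * ?r (n - m))
     = qbinom q (Suc (Suc n)) m * ?r (Suc (Suc n) - m)" if "m \<le> Suc (Suc n)" for m
  proof -
    have Pascal: "qbinom q (Suc (Suc n)) m * ?r (Suc (Suc n) - m)
        = (if m = 0 then 0 else ?c (m - 1)) + q ^ m * qbinom q (Suc n) m * ?r (Suc (Suc n) - m)"
      by (cases m) (simp_all add: qbinom_0[OF no_root] qbinom_Pascal[OF no_root] algebra_simps)
    have nb: "(1 - q ^ Suc m) * qbinom q (Suc n) (Suc m) = (1 - q ^ Suc n) * qbinom q n m"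
      by (rule qbinom_Suc_absorb[OF no_root])
    have "(1 - q ^ Suc m) * ?c (Suc m) = ((1 - q ^ Suc m) * qbinom q (Suc n) (Suc m)) * ?r (n - m)"
      by simp
    then have nbc: "(1 - q ^ Suc m) * ?c (Suc m) = (1 - q ^ Suc n) * qbinom q n m * ?r (n - m)"
      unfolding nb .
    \<comment> \<open>The Rogers--Szego recurrence times a Gaussian binomial, with absorption in the
      last term. For \<open>m = Suc n\<close> only the values of \<open>rogers_szego\<close> at 1
      and 0 enter; for \<open>m = Suc (Suc n)\<close> both sides are 0.\<close>
    have main: "qbinom q (Suc n) m * ?r (Suc (Suc n) - m)
        = (a + b) * ?c m - a * b * ((1 - q ^ Suc n) * qbinom q n m * ?r (n - m))"
    proof (cases "m \<le> n")
      case True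
      then have e: "Suc (Suc n) - m = Suc (Suc (n - m))" "Suc n - m = Suc (n - m)" by auto
      have "(1 - q ^ Suc n) * qbinom q n m = (1 - q ^ Suc (n - m)) * qbinom q (Suc n) m"
        using qbinom_absorb_comp[OF no_root, of n m] by (simp only: e)
      then show ?thesis
        unfolding e rogers_szego_rec[OF no_root] by (simp only:) (simp add: left_diff_distrib right_diff_distrib distrib_right distrib_left ac_simps)
    next
      case False
      then show ?thesis
        using that
        by (cases "m = Suc n") (simp_all add: rogers_szego_1[OF no_root] rogers_szego_0[OF no_root])
    qed
    have "(1 - a * b * q ^ (Suc m - 1)) * (1 - q ^ Suc m) * ?c (Suc m)
        = (1 - a * b * q ^ m) * ((1 - q ^ Suc n) * qbinom q n m * ?r (n - m))"
      unfolding nbc[symmetric] by (simp add: mult.assoc)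
    then show ?thesis
      unfolding Pascal mult.assoc[of "q ^ m"] main by (simp add: algebra_simps)
  qed
  have IH: "q_hermite q n = (\<Sum>m\<le>Suc (Suc n). smult (qbinom q n m * ?r (n - m)) (Q m))"
    using 3 by simp
  have "q_hermite q (Suc (Suc n))
     = [:0, 2:] * (\<Sum>m\<le>Suc n. smult (?c m) (Q m)) - smult (1 - q ^ Suc n) (q_hermite q n)"
    using 3 by (simp only: q_hermite.simps)
  also have "\<dots> = (\<Sum>m\<le>Suc (Suc n). smult (qbinom q (Suc (Suc n)) m * ?r (Suc (Suc n) - m)) (Q m))"
    unfolding IH smult_sum_right smult_smult
    by (subst three_term_sum[OF rec])
      (simp_all only: sum_subtractf[symmetric] smult_diff_left[symmetric]
        qbinom_eq_0 mult_zero_left power_0 diff_self mult_zero_right,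
       intro sum.cong refl arg_cong2[where f = smult] coeff, simp only: atMost_iff)
  finally show ?case .
qed

end

section \<open>Specialization to c = d = 0 and values of the functional\<close>

text \<open>Here \<open>aw_A\<close> becomes \<open>(1 - a*b*q^n) / a\<close> and
  \<open>aw_C\<close> becomes \<open>a * (1 - q^n)\<close>, so the terms in \<open>a\<close> and
  \<open>inverse a\<close> cancel.\<close>

lemma aw_b_c0_d0: "a \<noteq> 0 \<Longrightarrow> 2 * aw_b a b 0 0 q n = (a + b) * q ^ n"
  by (simp add: aw_b_def aw_A_def aw_C_def field_simps)

lemma aw_lambda_c0_d0:
  "a \<noteq> 0 \<Longrightarrow> 4 * aw_lambda a b 0 0 q (Suc n) = (1 - a * b * q ^ n) * (1 - q ^ Suc n)"
  by (simp add: aw_lambda_def aw_A_def aw_C_def)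

text \<open>The scaling by \<open>2 ^ m\<close> absorbs the factors 1/2 and 1/4 in
  \<open>aw_b\<close> and \<open>aw_lambda\<close>, giving the recurrence that
  \<open>q_hermite_eq_sum\<close> expects.\<close>

lemma scaled_aw_poly_rec:
  fixes a b q :: "'a::field_char_0"
  assumes "a \<noteq> 0"
  defines "Q \<equiv> \<lambda>m. smult (2 ^ m) (aw_poly a b 0 0 q m)"
  shows "[:0, 2:] * Q m = Q (Suc m) + smult ((a + b) * q ^ m) (Q m)
           + smult ((1 - a * b * q ^ (m - 1)) * (1 - q ^ m)) (Q (m - 1))"
proof (cases m)
  case 0
  then show ?thesis
    using aw_b_c0_d0[OF assms(1), of b q 0] by (simp add: Q_def)
next
  case (Suc n)
  have b: "(a + b) * q ^ Suc n = 2 * aw_b a b 0 0 q (Suc n)"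
    using aw_b_c0_d0[OF assms(1)] by metis
  have l: "(1 - a * b * q ^ n) * (1 - q ^ Suc n) = 4 * aw_lambda a b 0 0 q (Suc n)"
    using aw_lambda_c0_d0[OF assms(1)] by metis
  have lin: "[:- \<beta>, 1:] * p = [:0, 1:] * p - smult \<beta> p" for \<beta> :: 'a and p
    by simp
  have two: "[:0, 2:] * p = smult 2 ([:0, 1:] * p)" for p :: "'a poly"
    by simp
  show ?thesis
    unfolding Q_def Suc diff_Suc_1 b l aw_poly.simps two lin
    by (simp add: smult_diff_right smult_add_right algebra_simps del: mult_pCons_left)
qed

lemma linear_sum_smult:
  assumes "Vector_Spaces.linear smult (*) (L :: 'a::field poly \<Rightarrow> 'a)"
  shows "L (\<Sum>i\<in>A. smult (c i) (p i)) = (\<Sum>i\<in>A. c i * L (p i))"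
proof -
  interpret Vector_Spaces.linear smult "(*)" L by (fact assms)
  show ?thesis by (simp add: sum scale)
qed

text \<open>The functional annihilates every \<open>Q m\<close> with \<open>m \<ge> 1\<close>, so
  only the coefficient of \<open>Q 0\<close> survives.\<close>

lemma aw_functional_q_hermite:
  fixes a b q :: "'a::field_char_0"
  assumes "a \<noteq> 0" and no_root: "\<forall>m\<ge>1. q ^ m \<noteq> 1"
  shows "aw_functional a b 0 0 q (q_hermite q n) = rogers_szego a b q n"
proof -
  let ?L = "aw_functional a b 0 0 q"
  define Q where "Q m = smult (2 ^ m) (aw_poly a b 0 0 q m)" for m
  have L: "Vector_Spaces.linear smult (*) ?L" "?L 1 = 1" "\<And>n. n \<ge> 1 \<Longrightarrow> ?L (aw_poly a b 0 0 q n) = 0"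
    using is_aw_functional_aw_functional[of a b 0 0 q] by (auto simp: is_aw_functional_def)
  then have LQ: "?L (Q m) = (if m = 0 then 1 else 0)" for m
    by (auto simp: Q_def linear_poly_iff simp del: aw_poly.simps(2,3))
  have "q_hermite q n = (\<Sum>m\<le>n. smult (qbinom q n m * rogers_szego a b q (n - m)) (Q m))"
    by (rule q_hermite_eq_sum[OF no_root])
      (simp add: Q_def, unfold Q_def, rule scaled_aw_poly_rec[OF assms(1)])
  then have "?L (q_hermite q n) = (\<Sum>m\<le>n. qbinom q n m * rogers_szego a b q (n - m) * ?L (Q m))"
    by (simp only: linear_sum_smult[OF L(1)])
  also have "\<dots> = rogers_szego a b q n"
    by (simp add: LQ if_distrib[of "(*) _"] qbinom_0[OF no_root] cong: if_cong)
  finally show ?thesis .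
qed

lemma aw_functional_cheb_U:
  fixes a b q :: "'a::field_char_0"
  assumes "a \<noteq> 0" and no_root: "\<forall>m\<ge>1. q ^ m \<noteq> 1"
  shows "aw_functional a b 0 0 q (cheb_U k) =
    (\<Sum>(u, v, t) \<in> {(u, v, t). u + v + 2 * t = k}.
       a ^ u * b ^ v * (-1) ^ t * q ^ ((t + 1) choose 2) * qtrinomial q u v t)"
proof -
  let ?L = "aw_functional a b 0 0 q"
  have L: "Vector_Spaces.linear smult (*) ?L"
    using is_aw_functional_aw_functional[of a b 0 0 q] by (simp add: is_aw_functional_def)
  define d where "d t = (-1) ^ t * q ^ (Suc t choose 2) * qbinom q (k - t) t" for t
  have "?L (cheb_U k) = (\<Sum>t\<le>k. d t * rogers_szego a b q (k - 2 * t))"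
    unfolding cheb_U_eq_sum_q_hermite[OF no_root] linear_sum_smult[OF L]
      aw_functional_q_hermite[OF assms] d_def ..
  \<comment> \<open>For \<open>2 * t > k\<close> the lower index of the Gaussian binomial in
    \<open>d\<close> exceeds the upper one. Dropping these terms makes \<open>k - 2 * t\<close> a
    true difference.\<close>
  also have "\<dots> = (\<Sum>t | 2 * t \<le> k. d t * rogers_szego a b q (k - 2 * t))"
  proof (rule sum.mono_neutral_right)
    show "\<forall>t \<in> {..k} - {t. 2 * t \<le> k}. d t * rogers_szego a b q (k - 2 * t) = 0"
      by (auto simp: d_def intro!: qbinom_eq_0)
  qed auto
  also have "\<dots> = (\<Sum>t | 2 * t \<le> k. \<Sum>u\<le>k - 2 * t.
      d t * (qbinom q (k - 2 * t) u * a ^ u * b ^ (k - 2 * t - u)))"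
    by (simp only: rogers_szego_def sum_distrib_left)
  also have "\<dots> = (\<Sum>(t, u) \<in> (SIGMA t : {t. 2 * t \<le> k}. {..k - 2 * t}).
      d t * (qbinom q (k - 2 * t) u * a ^ u * b ^ (k - 2 * t - u)))"
    by (rule sum.Sigma) (auto intro: finite_subset[of _ "{..k}"])
  also have "\<dots> = (\<Sum>(u, v, t) \<in> {(u, v, t). u + v + 2 * t = k}.
       a ^ u * b ^ v * (-1) ^ t * q ^ ((t + 1) choose 2) * qtrinomial q u v t)"
  proof (rule sum.reindex_bij_witness[where i = "\<lambda>(u, v, t). (t, u)" and j = "\<lambda>(t, u). (u, k - 2 * t - u, t)"],
      goal_cases)
    case (5 x)
    then obtain t u where x: "x = (t, u)" "u + 2 * t \<le> k"
      by (cases x) auto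
    define v where "v = k - 2 * t - u"
    \<comment> \<open>In these variables the two Gaussian binomials have the shape required by
      \<open>qbinom_mult_qbinom\<close>.\<close>
    have e: "k - t = u + v + t" "k - 2 * t = u + v"
      using x by (auto simp: v_def)
    show ?case
      unfolding x(1) prod.case v_def[symmetric]
      unfolding d_def e qbinom_mult_qbinom[OF no_root, symmetric]
      by (simp add: ac_simps)
  qed auto
  finally show ?thesis .
qed

theorem corollary2p4:
  fixes a b q :: "'a::field_char_0" and n :: nat
  assumes "a \<noteq> 0"
    and "\<And>m::nat. m \<ge> 1 \<Longrightarrow> q ^ m \<noteq> 1"
  shows "2 ^ n * aw_moment n a b 0 0 q =
    (\<Sum>k=0..n.
       (of_nat (binom0 n ((of_nat n - of_nat k) / 2)) - of_nat (binom0 n ((of_nat n - of_nat k) / 2 - 1))) *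
       (\<Sum>(u, v, t) \<in> {(u, v, t). u + v + 2 * t = k}.
          a ^ u * b ^ v * (-1) ^ t * q ^ ((t + 1) choose 2) * qtrinomial q u v t))"
proof -
  have no_root: "\<forall>m\<ge>1. q ^ m \<noteq> 1" using assms(2) by blast
  let ?L = "aw_functional a b 0 0 q"
  have L: "Vector_Spaces.linear smult (*) ?L"
    using is_aw_functional_aw_functional[of a b 0 0 q] by (simp add: is_aw_functional_def)
  have "[:0, 2:] = monom (2::'a) 1"
    by (simp add: monom_Suc monom_0)
  then have "smult (2 ^ n) (monom 1 n) = [:0, 2 :: 'a:] ^ n"
    by (simp add: monom_power smult_monom)
  then have "2 ^ n * aw_moment n a b 0 0 q = ?L ([:0, 2:] ^ n)"
    using L unfolding aw_moment_def linear_poly_iff by metis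
  also have "\<dots> = (\<Sum>k\<le>n. ballot n ((of_nat n - of_nat k) / 2) * ?L (cheb_U k))"
    by (simp only: power_eq_sum_cheb_U linear_sum_smult[OF L])
  finally show ?thesis
    by (simp only: aw_functional_cheb_U[OF assms(1) no_root] ballot_def atMost_atLeast0)
qed

end
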